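(* Let $W_\alpha$ be a subnormal weighted shift, with bounded weight sequence $\alpha=\{\alpha_n\}_{n\ge 0}$ of positive numbers, and let $\gamma=\{\gamma_n\}_{n\ge 0}$ be its moment sequence. Then the following conditions are equivalent: (i) $W_\alpha$ is recursively generated; (ii) there exist integers $n_0,k\ge 0$ such that $\det([M_\gamma]_k^{n_0})=0$.
   Context: Given a bounded sequence of positive numbers $\alpha=\{\alpha_n\}_{n\ge 0}$ (weights), the unilateral weighted shift $W_\alpha$ is the bounded operator on $\ell^2(\mathbb{N})$ ($\mathbb{N}=\{0,1,2,\dots\}$) with $W_\alpha e_n=\alpha_n e_{n+1}$ for all $n\ge 0$, where $\{e_n\}_{n\ge 0}$ is the canonical orthonormal basis. Its moment sequence is defined by $\gamma_0=1$ and $\gamma_{n+1}=\alpha_n^2\gamma_n$ for $n\ge 0$. An operator $T$ on a Hilbert space $\mathcal{H}$ is subnormal if it is the restriction to $\mathcal{H}$ of a normal operator $N$ on some Hilbert space $\mathcal{K}\supseteq\mathcal{H}$. The shift $W_\alpha$ is called recursively generated if there exist an integer $r\ge 1$ and real numbers $a_0,\dots,a_{r-1}$ such that $\gamma_{m+r}=a_{r-1}\gamma_{m+r-1}+\cdots+a_1\gamma_{m+1}+a_0\gamma_m$ for every $m\ge 0$. For integers $k,n\ge 0$, $[M_\gamma]^n_k=(\gamma_{n+i+j})_{0\le i,j\le k}$ is the $(k+1)\times(k+1)$ Hankel matrix. *)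

theory Defs
  imports
    "HOL-Analysis.L2_Norm"
    "Jordan_Normal_Form.Determinant"
begin

section \<open>Complex Hilbert spaces and operators\<close>

text \<open>
  The inner product is linear in its first argument. Positive definiteness follows from
  \<open>cinner_self\<close> and the norm axioms, completeness is part of \<^class>\<open>banach\<close>.
\<close>

class chilbert_space = banach +
  fixes scaleC :: "complex \<Rightarrow> 'a \<Rightarrow> 'a"  (infixr \<open>*\<^sub>C\<close> 75)
    and cinner :: "'a \<Rightarrow> 'a \<Rightarrow> complex"
  assumes scaleC_add_right: "c *\<^sub>C (x + y) = c *\<^sub>C x + c *\<^sub>C y"
    and scaleC_add_left: "(c + d) *\<^sub>C x = c *\<^sub>C x + d *\<^sub>C x"
    and scaleC_scaleC: "c *\<^sub>C (d *\<^sub>C x) = (c * d) *\<^sub>C x"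
    and scaleC_of_real: "complex_of_real r *\<^sub>C x = r *\<^sub>R x"
    and cinner_commute: "cinner x y = cnj (cinner y x)"
    and cinner_add_left: "cinner (x + y) z = cinner x z + cinner y z"
    and cinner_scaleC_left: "cinner (c *\<^sub>C x) y = c * cinner x y"
    and cinner_self: "cinner x x = complex_of_real ((norm x)\<^sup>2)"

definition bounded_clinear :: "('a::chilbert_space \<Rightarrow> 'b::chilbert_space) \<Rightarrow> bool" where
  "bounded_clinear T \<longleftrightarrow> bounded_linear T \<and> (\<forall>c x. T (c *\<^sub>C x) = c *\<^sub>C T x)"

definition has_adjoint :: "('a::chilbert_space \<Rightarrow> 'a) \<Rightarrow> ('a \<Rightarrow> 'a) \<Rightarrow> bool" where
  "has_adjoint N M \<longleftrightarrow> bounded_clinear M \<and> (\<forall>x y. cinner (N x) y = cinner x (M y))"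

lemma has_adjoint_unique:
  assumes "has_adjoint N M" "has_adjoint N M'"
  shows "M = M'"
proof
  fix y :: 'a
  define d where "d = M y - M' y"
  have eq: "cinner x (M y) = cinner x (M' y)" for x
    using assms by (simp add: has_adjoint_def)
  have "cinner (M y) x = cinner (M' y) x" for x
    by (metis eq cinner_commute)
  then have "cinner d d + cinner (M' y) d = cinner (M' y) d"
    using cinner_add_left[of d "M' y" d] by (simp add: d_def)
  then have "norm d = 0"
    by (simp add: cinner_self)
  then show "M y = M' y"
    by (simp add: d_def)
qed

definition normal_operator :: "('a::chilbert_space \<Rightarrow> 'a) \<Rightarrow> bool" where
  "normal_operator N \<longleftrightarrow>
     bounded_clinear N \<and> (\<exists>M. has_adjoint N M \<and> N \<circ> M = M \<circ> N)"

definition isometric_embedding :: "('a::chilbert_space \<Rightarrow> 'b::chilbert_space) \<Rightarrow> bool" where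
  "isometric_embedding V \<longleftrightarrow>
     bounded_clinear V \<and> (\<forall>x y. cinner (V x) (V y) = cinner x y)"

text \<open>
  \<open>subnormal_in TYPE('k) T\<close>: the operator \<open>T\<close> on \<open>'h\<close> is the restriction to \<open>'h\<close> of a normal
  operator on the Hilbert space \<open>'k\<close>, where \<open>'h\<close> is regarded as a subspace of \<open>'k\<close> by means of an
  isometric embedding \<open>V\<close>. HOL has no quantifier over types, so ``\<open>T\<close> is subnormal'' in a
  hypothesis is expressed by \<open>subnormal_in TYPE('k) T\<close> for a type variable \<open>'k\<close> that occurs nowhere
  else: the resulting theorem holds for every \<open>'k\<close>, i.e.\ as soon as some \<open>'k\<close> exists.
\<close>

definition subnormal_in :: "'k::chilbert_space itself \<Rightarrow> ('h::chilbert_space \<Rightarrow> 'h) \<Rightarrow> bool" where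
  "subnormal_in _ T \<longleftrightarrow> bounded_clinear T \<and>
     (\<exists>(V :: 'h \<Rightarrow> 'k) N. isometric_embedding V \<and> normal_operator N \<and> (\<forall>x. N (V x) = V (T x)))"


section \<open>The sequence space\<close>

typedef ell2 = "{x :: nat \<Rightarrow> complex. summable (\<lambda>n. (cmod (x n))\<^sup>2)}"
  morphisms coord Abs_ell2
  by (rule exI[of _ "\<lambda>_. 0"]) simp

setup_lifting type_definition_ell2

lemma summable_coord: "summable (\<lambda>n. (cmod (coord x n))\<^sup>2)"
  using coord[of x] by simp

lemma ell2_eqI: "(\<And>n. coord x n = coord y n) \<Longrightarrow> x = y"
  by (metis coord_inject ext)

lemma summable_sq_add:
  assumes "summable (\<lambda>n. (cmod (x n))\<^sup>2)" "summable (\<lambda>n. (cmod (y n))\<^sup>2)"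
  shows "summable (\<lambda>n. (cmod (x n + y n))\<^sup>2)"
proof (rule summable_comparison_test')
  show "summable (\<lambda>n. 2 * (cmod (x n))\<^sup>2 + 2 * (cmod (y n))\<^sup>2)"
    using assms by (intro summable_add summable_mult)
  fix n :: nat
  have "(cmod (x n + y n))\<^sup>2 \<le> (cmod (x n) + cmod (y n))\<^sup>2"
    by (intro power_mono norm_triangle_ineq) simp
  also have "\<dots> \<le> 2 * (cmod (x n))\<^sup>2 + 2 * (cmod (y n))\<^sup>2"
    using zero_le_power2[of "cmod (x n) - cmod (y n)"] by (simp add: power2_eq_square algebra_simps)
  finally show "norm ((cmod (x n + y n))\<^sup>2) \<le> 2 * (cmod (x n))\<^sup>2 + 2 * (cmod (y n))\<^sup>2"
    by simp
qed

lemma summable_sq_scale: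
  assumes "summable (\<lambda>n. (cmod (x n))\<^sup>2)"
  shows "summable (\<lambda>n. (cmod (c * x n))\<^sup>2)"
  using summable_mult[OF assms, of "(cmod c)\<^sup>2"] by (simp add: norm_mult power_mult_distrib)

lemma summable_coord_cnj: "summable (\<lambda>n. coord x n * cnj (coord y n))"
proof (rule summable_comparison_test')
  show "summable (\<lambda>n. (cmod (coord x n))\<^sup>2 + (cmod (coord y n))\<^sup>2)"
    by (intro summable_add summable_coord)
  fix n :: nat
  have "2 * (cmod (coord x n) * cmod (coord y n)) \<le> (cmod (coord x n))\<^sup>2 + (cmod (coord y n))\<^sup>2"
    using sum_squares_bound[of "cmod (coord x n)" "cmod (coord y n)"] by simp
  moreover have "0 \<le> cmod (coord x n) * cmod (coord y n)"
    by simp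
  ultimately show "norm (coord x n * cnj (coord y n)) \<le> (cmod (coord x n))\<^sup>2 + (cmod (coord y n))\<^sup>2"
    by (simp only: norm_mult complex_mod_cnj)
qed

instantiation ell2 :: real_vector
begin
lift_definition zero_ell2 :: ell2 is "\<lambda>_. 0" by simp
lift_definition plus_ell2 :: "ell2 \<Rightarrow> ell2 \<Rightarrow> ell2" is "\<lambda>x y n. x n + y n"
  by (rule summable_sq_add)
lift_definition uminus_ell2 :: "ell2 \<Rightarrow> ell2" is "\<lambda>x n. - x n" by simp
lift_definition minus_ell2 :: "ell2 \<Rightarrow> ell2 \<Rightarrow> ell2" is "\<lambda>x y n. x n - y n"
  using summable_sq_add[of _ "\<lambda>n. - _ n"] by force
lift_definition scaleR_ell2 :: "real \<Rightarrow> ell2 \<Rightarrow> ell2" is "\<lambda>r x n. complex_of_real r * x n"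
  by (rule summable_sq_scale)
instance
  by standard (transfer; simp add: algebra_simps fun_eq_iff)+
end

instantiation ell2 :: real_normed_vector
begin
definition norm_ell2 :: "ell2 \<Rightarrow> real" where
  "norm_ell2 x = sqrt (\<Sum>n. (cmod (coord x n))\<^sup>2)"
definition sgn_ell2 :: "ell2 \<Rightarrow> ell2" where
  "sgn_ell2 x = x /\<^sub>R norm x"
definition dist_ell2 :: "ell2 \<Rightarrow> ell2 \<Rightarrow> real" where
  "dist_ell2 x y = norm (x - y)"
definition uniformity_ell2 :: "(ell2 \<times> ell2) filter" where
  "uniformity_ell2 = (INF e\<in>{0<..}. principal {(x, y). dist x y < e})"
definition open_ell2 :: "ell2 set \<Rightarrow> bool" where
  "open_ell2 U \<longleftrightarrow> (\<forall>x\<in>U. eventually (\<lambda>(x', y). x' = x \<longrightarrow> y \<in> U) uniformity)"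

lemma L2_set_coord_le: "L2_set (\<lambda>n. cmod (coord x n)) {..<k} \<le> norm x"
  unfolding L2_set_def norm_ell2_def
  by (intro real_sqrt_le_mono sum_le_suminf summable_coord) auto

lemma norm_ell2_leI:
  assumes "\<And>k. L2_set (\<lambda>n. cmod (coord x n)) {..<k} \<le> b"
  shows "norm x \<le> b"
proof -
  have b: "b \<ge> 0" using assms[of 0] by simp
  have "(\<Sum>n. (cmod (coord x n))\<^sup>2) \<le> b\<^sup>2"
  proof (rule suminf_le_const[OF summable_coord])
    fix k
    show "(\<Sum>n<k. (cmod (coord x n))\<^sup>2) \<le> b\<^sup>2"
      using assms[of k] unfolding L2_set_def by (rule sqrt_le_D)
  qed
  then show ?thesis
    unfolding norm_ell2_def by (rule real_le_lsqrt[OF b])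
qed

instance
proof
  fix x y :: ell2 and a :: real
  show "norm x = 0 \<longleftrightarrow> x = 0"
  proof -
    have "norm x = 0 \<longleftrightarrow> (\<forall>n. coord x n = 0)"
      unfolding norm_ell2_def by (simp add: suminf_eq_zero_iff summable_coord)
    then show ?thesis
      by (auto intro: ell2_eqI simp: zero_ell2.rep_eq)
  qed
  show "norm (x + y) \<le> norm x + norm y"
  proof (rule norm_ell2_leI)
    fix k
    have "L2_set (\<lambda>n. cmod (coord (x + y) n)) {..<k}
        \<le> L2_set (\<lambda>n. cmod (coord x n) + cmod (coord y n)) {..<k}"
      by (intro L2_set_mono) (auto simp: plus_ell2.rep_eq norm_triangle_ineq)
    also have "\<dots> \<le> L2_set (\<lambda>n. cmod (coord x n)) {..<k} + L2_set (\<lambda>n. cmod (coord y n)) {..<k}"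
      by (rule L2_set_triangle_ineq)
    also have "\<dots> \<le> norm x + norm y"
      by (intro add_mono L2_set_coord_le)
    finally show "L2_set (\<lambda>n. cmod (coord (x + y) n)) {..<k} \<le> norm x + norm y" .
  qed
  show "norm (a *\<^sub>R x) = \<bar>a\<bar> * norm x"
    unfolding norm_ell2_def
    by (simp add: scaleR_ell2.rep_eq norm_mult power_mult_distrib suminf_mult summable_coord
        real_sqrt_mult)
qed (simp_all add: sgn_ell2_def dist_ell2_def uniformity_ell2_def open_ell2_def)
end

lemma cmod_coord_le: "cmod (coord x n) \<le> norm x"
proof -
  have "cmod (coord x n) \<le> L2_set (\<lambda>n. cmod (coord x n)) {..<Suc n}"
    by (rule member_le_L2_set[where f = "\<lambda>n. cmod (coord x n)"]) auto
  also have "\<dots> \<le> norm x" by (rule L2_set_coord_le)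
  finally show ?thesis .
qed

instance ell2 :: banach
proof
  fix X :: "nat \<Rightarrow> ell2"
  assume "Cauchy X"
  have "Cauchy (\<lambda>m. coord (X m) n)" for n
  proof (rule metric_CauchyI)
    fix e :: real assume "e > 0"
    then obtain M where "\<forall>m\<ge>M. \<forall>k\<ge>M. dist (X m) (X k) < e"
      using \<open>Cauchy X\<close> by (meson metric_CauchyD)
    moreover have "dist (coord (X m) n) (coord (X k) n) \<le> dist (X m) (X k)" for m k
      using cmod_coord_le[of "X m - X k" n] by (simp add: dist_norm minus_ell2.rep_eq)
    ultimately show "\<exists>M. \<forall>m\<ge>M. \<forall>k\<ge>M. dist (coord (X m) n) (coord (X k) n) < e"
      by (meson le_less_trans)
  qed
  then have "\<exists>l. (\<lambda>m. coord (X m) n) \<longlonglongrightarrow> l" for n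
    by (simp add: Cauchy_convergent_iff convergent_def)
  then obtain L where L: "\<And>n. (\<lambda>m. coord (X m) n) \<longlonglongrightarrow> L n"
    by metis
  have bound: "\<exists>M. \<forall>m\<ge>M. \<forall>k. L2_set (\<lambda>n. cmod (coord (X m) n - L n)) {..<k} \<le> e"
    if "e > 0" for e
  proof -
    obtain M where M: "\<And>m j. m \<ge> M \<Longrightarrow> j \<ge> M \<Longrightarrow> dist (X m) (X j) < e"
      using metric_CauchyD[OF \<open>Cauchy X\<close> \<open>e > 0\<close>] by metis
    have "L2_set (\<lambda>n. cmod (coord (X m) n - L n)) {..<k} \<le> e" if "m \<ge> M" for m k
    proof (rule LIMSEQ_le_const2)
      show "(\<lambda>j. L2_set (\<lambda>n. cmod (coord (X m) n - coord (X j) n)) {..<k})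
          \<longlonglongrightarrow> L2_set (\<lambda>n. cmod (coord (X m) n - L n)) {..<k}"
        unfolding L2_set_def by (intro tendsto_intros L)
      have "L2_set (\<lambda>n. cmod (coord (X m) n - coord (X j) n)) {..<k} \<le> e" if "j \<ge> M" for j
        using L2_set_coord_le[of "X m - X j" k] M[OF \<open>m \<ge> M\<close> that]
        by (simp add: dist_norm minus_ell2.rep_eq)
      then show "\<exists>N. \<forall>j\<ge>N. L2_set (\<lambda>n. cmod (coord (X m) n - coord (X j) n)) {..<k} \<le> e"
        by blast
    qed
    then show ?thesis by blast
  qed
  have "summable (\<lambda>n. (cmod (L n))\<^sup>2)"
  proof -
    obtain M where M: "\<And>k. L2_set (\<lambda>n. cmod (coord (X M) n - L n)) {..<k} \<le> 1"
      using bound[of 1] by auto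
    have "summable (\<lambda>n. (cmod (coord (X M) n - L n))\<^sup>2)"
    proof (rule summableI_nonneg_bounded[of _ "1\<^sup>2"])
      fix k
      show "(\<Sum>n<k. (cmod (coord (X M) n - L n))\<^sup>2) \<le> 1\<^sup>2"
        using M[of k] by (simp add: L2_set_def)
    qed simp
    from summable_sq_add[OF summable_sq_scale[OF this, of "-1"] summable_coord[of "X M"]]
    show ?thesis by simp
  qed
  then have coord_L: "coord (Abs_ell2 L) = L"
    by (simp add: Abs_ell2_inverse)
  have "X \<longlonglongrightarrow> Abs_ell2 L"
  proof (rule LIMSEQ_I)
    fix e :: real assume "e > 0"
    then obtain M where M: "\<And>m k. m \<ge> M \<Longrightarrow> L2_set (\<lambda>n. cmod (coord (X m) n - L n)) {..<k} \<le> e / 2"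
      using bound[of "e / 2"] by auto
    have "norm (X m - Abs_ell2 L) < e" if "m \<ge> M" for m
    proof -
      have "norm (X m - Abs_ell2 L) \<le> e / 2"
        using M[OF that] by (intro norm_ell2_leI) (simp add: minus_ell2.rep_eq coord_L)
      then show ?thesis using \<open>e > 0\<close> by simp
    qed
    then show "\<exists>M. \<forall>m\<ge>M. norm (X m - Abs_ell2 L) < e" by blast
  qed
  then show "convergent X" by (auto simp: convergent_def)
qed

instantiation ell2 :: chilbert_space
begin
lift_definition scaleC_ell2 :: "complex \<Rightarrow> ell2 \<Rightarrow> ell2" is "\<lambda>c x n. c * x n"
  by (rule summable_sq_scale)
definition cinner_ell2 :: "ell2 \<Rightarrow> ell2 \<Rightarrow> complex" where
  "cinner_ell2 x y = (\<Sum>n. coord x n * cnj (coord y n))"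
instance
proof
  fix x y z :: ell2 and c d :: complex and r :: real
  show "c *\<^sub>C (x + y) = c *\<^sub>C x + c *\<^sub>C y" by transfer (simp add: algebra_simps)
  show "(c + d) *\<^sub>C x = c *\<^sub>C x + d *\<^sub>C x" by transfer (simp add: algebra_simps)
  show "c *\<^sub>C (d *\<^sub>C x) = (c * d) *\<^sub>C x" by transfer (simp add: algebra_simps)
  show "complex_of_real r *\<^sub>C x = r *\<^sub>R x" by transfer simp
  show "cinner x y = cnj (cinner y x)"
  proof -
    have "(\<lambda>n. coord y n * cnj (coord x n)) sums cinner y x"
      unfolding cinner_ell2_def by (rule summable_sums[OF summable_coord_cnj])
    then have "(\<lambda>n. cnj (coord y n * cnj (coord x n))) sums cnj (cinner y x)"
      by (simp only: sums_cnj)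
    then show ?thesis
      unfolding cinner_ell2_def by (simp add: sums_iff mult.commute)
  qed
  show "cinner (x + y) z = cinner x z + cinner y z"
    unfolding cinner_ell2_def
    by (simp add: plus_ell2.rep_eq distrib_right suminf_add summable_coord_cnj)
  show "cinner (c *\<^sub>C x) y = c * cinner x y"
    unfolding cinner_ell2_def
    by (simp add: scaleC_ell2.rep_eq mult.assoc suminf_mult summable_coord_cnj)
  show "cinner x x = complex_of_real ((norm x)\<^sup>2)"
  proof -
    have "cinner x x = (\<Sum>n. complex_of_real ((cmod (coord x n))\<^sup>2))"
      unfolding cinner_ell2_def by (simp add: complex_norm_square del: of_real_power)
    also have "\<dots> = complex_of_real (\<Sum>n. (cmod (coord x n))\<^sup>2)"
      by (rule suminf_of_real[OF summable_coord, symmetric])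
    finally show ?thesis
      by (simp add: norm_ell2_def suminf_nonneg summable_coord)
  qed
qed
end

lift_definition ket :: "nat \<Rightarrow> ell2" is "\<lambda>m n. if n = m then 1 else 0"
proof -
  fix m :: nat
  show "summable (\<lambda>n. (cmod (if n = m then 1 else 0))\<^sup>2)"
    by (rule summable_finite[of "{m}"]) auto
qed


section \<open>Weighted shifts\<close>

text \<open>
  Meaningful for bounded weights only, where the sequence on the right is square summable; the
  lemmas below show that this is then the bounded operator determined by its action on the basis.
\<close>

definition weighted_shift :: "(nat \<Rightarrow> real) \<Rightarrow> ell2 \<Rightarrow> ell2" where
  "weighted_shift \<alpha> x =
     Abs_ell2 (\<lambda>n. case n of 0 \<Rightarrow> 0 | Suc m \<Rightarrow> complex_of_real (\<alpha> m) * coord x m)"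

lemma
  assumes b: "\<And>n. \<bar>\<alpha> n\<bar> \<le> b"
  shows coord_weighted_shift:
      "coord (weighted_shift \<alpha> x) n =
         (case n of 0 \<Rightarrow> 0 | Suc m \<Rightarrow> complex_of_real (\<alpha> m) * coord x m)" (is ?c)
    and norm_weighted_shift_le: "norm (weighted_shift \<alpha> x) \<le> b * norm x" (is ?n)
proof -
  let ?y = "\<lambda>n. case n of 0 \<Rightarrow> 0 | Suc m \<Rightarrow> complex_of_real (\<alpha> m) * coord x m"
  have b0: "b \<ge> 0" using b[of 0] by simp
  have le: "(cmod (?y (Suc n)))\<^sup>2 \<le> b\<^sup>2 * (cmod (coord x n))\<^sup>2" for n
    using b[of n] by (auto simp: norm_mult power_mult_distrib intro!: mult_right_mono abs_le_square_iff[THEN iffD1])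
  have sb: "summable (\<lambda>n. b\<^sup>2 * (cmod (coord x n))\<^sup>2)"
    by (intro summable_mult summable_coord)
  have s: "summable (\<lambda>n. (cmod (?y (Suc n)))\<^sup>2)"
    by (rule summable_comparison_test'[OF sb, of 0]) (use le in simp)
  then have s': "summable (\<lambda>n. (cmod (?y n))\<^sup>2)"
    by (subst (asm) summable_Suc_iff)
  then have c: "coord (weighted_shift \<alpha> x) = ?y"
    by (simp add: weighted_shift_def Abs_ell2_inverse)
  then show ?c by simp
  have "(\<Sum>n. (cmod (?y n))\<^sup>2) = (\<Sum>n. (cmod (?y (Suc n)))\<^sup>2)"
    using suminf_split_head[OF s'] by simp
  also have "\<dots> \<le> (\<Sum>n. b\<^sup>2 * (cmod (coord x n))\<^sup>2)"
    by (rule suminf_le[OF le s sb])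
  also have "\<dots> = b\<^sup>2 * (\<Sum>n. (cmod (coord x n))\<^sup>2)"
    by (rule suminf_mult[OF summable_coord])
  finally have "sqrt (\<Sum>n. (cmod (?y n))\<^sup>2) \<le> sqrt (b\<^sup>2 * (\<Sum>n. (cmod (coord x n))\<^sup>2))"
    by (rule real_sqrt_le_mono)
  then show ?n
    using b0 unfolding norm_ell2_def c by (simp add: real_sqrt_mult)
qed

lemma weighted_shift_ket:
  assumes "\<And>n. \<bar>\<alpha> n\<bar> \<le> b"
  shows "weighted_shift \<alpha> (ket n) = complex_of_real (\<alpha> n) *\<^sub>C ket (Suc n)"
  by (rule ell2_eqI)
    (auto simp: coord_weighted_shift[of \<alpha>, OF assms] scaleC_ell2.rep_eq ket.rep_eq split: nat.splits)

lemma bounded_clinear_weighted_shift: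
  assumes "\<And>n. \<bar>\<alpha> n\<bar> \<le> b"
  shows "bounded_clinear (weighted_shift \<alpha>)"
  unfolding bounded_clinear_def
proof (intro conjI allI bounded_linear_intro)
  note c = coord_weighted_shift[of \<alpha>, OF assms]
  show "weighted_shift \<alpha> (x + y) = weighted_shift \<alpha> x + weighted_shift \<alpha> y" for x y
    by (rule ell2_eqI) (simp add: c plus_ell2.rep_eq algebra_simps split: nat.splits)
  show "weighted_shift \<alpha> (r *\<^sub>R x) = r *\<^sub>R weighted_shift \<alpha> x" for r x
    by (rule ell2_eqI) (simp add: c scaleR_ell2.rep_eq algebra_simps split: nat.splits)
  show "weighted_shift \<alpha> (r *\<^sub>C x) = r *\<^sub>C weighted_shift \<alpha> x" for r x
    by (rule ell2_eqI) (simp add: c scaleC_ell2.rep_eq algebra_simps split: nat.splits)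
  show "norm (weighted_shift \<alpha> x) \<le> norm x * b" for x
    using norm_weighted_shift_le[of \<alpha>, OF assms] by (simp add: mult.commute)
qed

primrec moment :: "(nat \<Rightarrow> real) \<Rightarrow> nat \<Rightarrow> real" where
  "moment \<alpha> 0 = 1"
| "moment \<alpha> (Suc n) = (\<alpha> n)\<^sup>2 * moment \<alpha> n"

definition recursively_generated :: "(nat \<Rightarrow> real) \<Rightarrow> bool" where
  "recursively_generated \<alpha> \<longleftrightarrow>
     (\<exists>r\<ge>1. \<exists>a :: nat \<Rightarrow> real. \<forall>m. moment \<alpha> (m + r) = (\<Sum>i<r. a i * moment \<alpha> (m + i)))"

definition hankel_matrix :: "(nat \<Rightarrow> real) \<Rightarrow> nat \<Rightarrow> nat \<Rightarrow> real mat" where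
  "hankel_matrix \<gamma> n k = mat (k + 1) (k + 1) (\<lambda>(i, j). \<gamma> (n + i + j))"

end

theory Submission
  imports Defs
begin

text \<open>
  If \<open>N\<close> is a normal extension of \<open>W\<^sub>\<alpha>\<close> and \<open>A = N\<^sup>*N\<close>, then \<open>\<gamma>\<^sub>n = \<langle>A\<^sup>n e\<^sub>0, e\<^sub>0\<rangle>\<close>. A null vector \<open>v\<close>
  of the Hankel matrix gives \<open>p(t) = \<Sum>\<^sub>j v\<^sub>j t\<^sup>j\<close> with \<open>\<parallel>N\<^bsup>n\<^sub>0\<^esup> p(A) e\<^sub>0\<parallel>\<^sup>2 = v\<^sup>T H v = 0\<close>. As \<open>ker N\<^sup>n = ker N\<close>
  for normal \<open>N\<close> and \<open>n \<ge> 1\<close>, the vector \<open>N p(A) e\<^sub>0\<close> vanishes, and pairing it with \<open>N A\<^sup>m e\<^sub>0\<close> yields the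
  recursion \<open>\<Sum>\<^sub>j v\<^sub>j \<gamma>\<^bsub>m+1+j\<^esub> = 0\<close>.
\<close>

lemma cinner_scaleR_left: "cinner (r *\<^sub>R x) y = complex_of_real r * cinner x y"
  by (metis scaleC_of_real cinner_scaleC_left)

lemma cinner_zero_left [simp]: "cinner 0 y = 0"
  using cinner_scaleR_left[of 0 0 y] by simp

lemma cinner_sum_left: "cinner (sum f S) y = (\<Sum>i\<in>S. cinner (f i) y)"
  by (induction S rule: infinite_finite_induct) (simp_all add: cinner_add_left)

lemma cinner_eq_zero_iff: "cinner x x = 0 \<longleftrightarrow> x = 0"
  by (simp add: cinner_self)

lemma linear_funpow:
  fixes N :: "'a::real_vector \<Rightarrow> 'a"
  assumes "linear N"
  shows "linear (N ^^ n)"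
proof (induction n)
  case 0
  show ?case using linear_id by (simp add: id_def)
next
  case (Suc n)
  then show ?case using linear_compose[OF _ assms] by (simp add: comp_def)
qed

lemma has_adjoint_funpow:
  assumes "has_adjoint N M"
  shows "cinner ((N ^^ n) x) y = cinner x ((M ^^ n) y)"
    and "cinner ((M ^^ n) x) y = cinner x ((N ^^ n) y)"
proof -
  have a: "cinner (N x) y = cinner x (M y)" for x y
    using assms by (simp add: has_adjoint_def)
  have b: "cinner (M x) y = cinner x (N y)" for x y
    by (metis a cinner_commute)
  show "cinner ((N ^^ n) x) y = cinner x ((M ^^ n) y)"
    by (induction n arbitrary: y) (simp_all add: a funpow_swap1[of M])
  show "cinner ((M ^^ n) x) y = cinner x ((N ^^ n) y)"
    by (induction n arbitrary: y) (simp_all add: b funpow_swap1[of N])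
qed

lemma funpow_commute:
  assumes "\<And>x. N (M x) = M (N x)"
  shows "(N ^^ a) ((M ^^ b) x) = (M ^^ b) ((N ^^ a) x)"
proof -
  have "N ((M ^^ b) x) = (M ^^ b) (N x)" for x
    by (induction b) (simp_all add: assms)
  then show ?thesis
    by (induction a) simp_all
qed

text \<open>Each \<open>M\<close> crosses the inner product and becomes an \<open>N\<close> on the
  other side; commutation then collects \<open>n + i + j\<close> copies of \<open>N\<close> in both
  arguments. Thus the Gram matrix of these vectors has Hankel form.\<close>

lemma cinner_normal_powers:
  assumes adj: "has_adjoint N M" and com: "\<And>x. N (M x) = M (N x)"
  shows "cinner ((N ^^ n) ((M ^^ j) ((N ^^ j) x))) ((N ^^ n) ((M ^^ i) ((N ^^ i) x))) =
    complex_of_real ((norm ((N ^^ (n + i + j)) x))\<^sup>2)"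
proof -
  note adj_pow = has_adjoint_funpow[OF adj] and com_pow = funpow_commute[of N M, OF com]
  have "cinner ((N ^^ n) ((M ^^ j) ((N ^^ j) x))) ((N ^^ n) ((M ^^ i) ((N ^^ i) x))) =
      cinner ((M ^^ j) ((N ^^ (n + j)) x)) ((M ^^ i) ((N ^^ (n + i)) x))"
    by (simp add: com_pow funpow_add)
  also have "\<dots> = cinner ((N ^^ (i + (n + j))) x) ((N ^^ (j + (n + i))) x)"
    by (simp add: adj_pow(1)[symmetric] adj_pow(2) com_pow funpow_add)
  also have "\<dots> = complex_of_real ((norm ((N ^^ (n + i + j)) x))\<^sup>2)"
    by (simp add: cinner_self ac_simps)
  finally show ?thesis .
qed

text \<open>Powers of \<open>N\<close> are stripped one at a time. If \<open>N (N z) = 0\<close>,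
  adjointness and commutation give first \<open>M (N z) = 0\<close> and then \<open>N z = 0\<close>,
  each because the squared norm vanishes.\<close>

lemma normal_funpow_eq_zero:
  assumes adj: "has_adjoint N M" and com: "\<And>x. N (M x) = M (N x)" and lin: "linear N"
    and zero: "(N ^^ n) y = 0"
  shows "N y = 0"
proof -
  have step: "N z = 0" if "N (N z) = 0" for z
  proof -
    have "cinner (M (N z)) (M (N z)) = cinner (N (M (N z))) (N z)"
      using has_adjoint_funpow(1)[OF adj, of 1] by simp
    also have "\<dots> = 0"
      using has_adjoint_funpow(2)[OF adj, of 1 "N (N z)" "N z"]
      by (simp add: com that)
    finally have "M (N z) = 0"
      by (simp add: cinner_eq_zero_iff)
    then have "cinner (N z) (N z) = 0"
      using has_adjoint_funpow(2)[OF adj, of 1 "N z" z] by simp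
    then show ?thesis
      by (simp add: cinner_eq_zero_iff)
  qed
  from zero show ?thesis
  proof (induction n)
    case 0
    then show ?case by (simp add: linear_0[OF lin])
  next
    case (Suc n)
    \<comment> \<open>For \<open>n = 0\<close> the premise is already the goal; otherwise two outer
      copies of \<open>N\<close> are present and \<open>step\<close> removes one.\<close>
    then show ?case by (cases n) (auto dest: step)
  qed
qed

text \<open>The \<open>k + 1\<close> null equations suffice to make \<open>N y\<close> vanish for
  one fixed vector \<open>y\<close>; pairing \<open>N y\<close> with arbitrary vectors then gives an
  equation for every \<open>m\<close>.\<close>

lemma normal_orbit_recursion:
  fixes N :: "'a::chilbert_space \<Rightarrow> 'a" and v :: "nat \<Rightarrow> real"
  assumes "normal_operator N"
    and null: "\<And>i. i \<le> k \<Longrightarrow> (\<Sum>j\<le>k. v j * (norm ((N ^^ (n + i + j)) x))\<^sup>2) = 0"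
  shows "(\<Sum>j\<le>k. v j * (norm ((N ^^ (Suc m + j)) x))\<^sup>2) = 0"
proof -
  obtain M where adj: "has_adjoint N M" and com: "\<And>x. N (M x) = M (N x)"
    using assms(1) by (auto simp: normal_operator_def fun_eq_iff)
  have lin: "linear N"
    using assms(1) by (simp add: normal_operator_def bounded_clinear_def bounded_linear.linear)
  define u where "u j = (M ^^ j) ((N ^^ j) x)" for j
  define y where "y = (\<Sum>j\<le>k. v j *\<^sub>R u j)"
  have Ny: "(N ^^ l) y = (\<Sum>j\<le>k. v j *\<^sub>R (N ^^ l) (u j))" for l
    by (simp add: y_def linear_sum[OF linear_funpow[OF lin]] linear_scale[OF linear_funpow[OF lin]])
  have pair: "cinner ((N ^^ l) y) ((N ^^ l) (u i)) =
      complex_of_real (\<Sum>j\<le>k. v j * (norm ((N ^^ (l + i + j)) x))\<^sup>2)" for l i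
    unfolding Ny cinner_sum_left cinner_scaleR_left u_def cinner_normal_powers[OF adj com]
    by simp
  \<comment> \<open>Since \<open>y\<close> is a combination of these \<open>u i\<close>,
    \<open>(N ^^ n) y\<close> is orthogonal to itself. Swapping the arguments puts
    \<open>u i\<close> into the linear slot, where \<open>y\<close> is expanded.\<close>
  have "cinner ((N ^^ n) (u i)) ((N ^^ n) y) = 0" if "i \<le> k" for i
    using pair[of n i] null[OF that] by (metis cinner_commute complex_cnj_zero of_real_0)
  then have "cinner ((N ^^ n) y) ((N ^^ n) y) = 0"
    by (subst Ny) (simp add: cinner_sum_left cinner_scaleR_left)
  then have "N y = 0"
    using normal_funpow_eq_zero[OF adj com lin] by (simp add: cinner_eq_zero_iff)
  \<comment> \<open>The single \<open>N\<close> left in \<open>N y = 0\<close> is why the indices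
    start at \<open>1 + m\<close> and not at \<open>m\<close>.\<close>
  then have "complex_of_real (\<Sum>j\<le>k. v j * (norm ((N ^^ (1 + m + j)) x))\<^sup>2) = 0"
    unfolding pair[of 1 m, symmetric] by simp
  then show ?thesis
    unfolding of_real_eq_0_iff by simp
qed

lemma norm_scaleC: "norm (c *\<^sub>C x) = cmod c * norm x"
proof -
  have "cinner (c *\<^sub>C x) (c *\<^sub>C x) = c * cnj c * cinner x x"
    by (metis cinner_commute cinner_scaleC_left complex_cnj_mult mult.assoc)
  then have "complex_of_real ((norm (c *\<^sub>C x))\<^sup>2) = complex_of_real ((cmod c * norm x)\<^sup>2)"
    by (simp add: cinner_self complex_norm_square[symmetric] power_mult_distrib)
  then show ?thesis
    by (metis of_real_eq_iff norm_ge_zero mult_nonneg_nonneg power2_eq_iff_nonneg)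
qed

lemma norm_ket: "norm (ket n) = 1"
proof -
  have "(\<lambda>m. (cmod (coord (ket n) m))\<^sup>2) = (\<lambda>m. if m = n then 1 else 0)"
    by (auto simp: ket.rep_eq)
  then show ?thesis
    using sums_single[of n "\<lambda>_. 1::real"] by (simp add: norm_ell2_def sums_iff)
qed

text \<open>The orbit of \<open>ket 0\<close> consists of multiples of basis vectors by products of
  weights. Reading moments as squared orbit norms lets an isometric embedding transfer them to a
  normal extension.\<close>

lemma norm_weighted_shift_funpow_ket:
  assumes b: "\<And>n. \<bar>\<alpha> n\<bar> \<le> b"
  shows "(norm ((weighted_shift \<alpha> ^^ n) (ket 0)))\<^sup>2 = moment \<alpha> n"
proof -
  have T: "weighted_shift \<alpha> (c *\<^sub>C x) = c *\<^sub>C weighted_shift \<alpha> x" for c x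
    using bounded_clinear_weighted_shift[OF b] by (simp add: bounded_clinear_def)
  have "(weighted_shift \<alpha> ^^ n) (ket 0) = complex_of_real (\<Prod>i<n. \<alpha> i) *\<^sub>C ket n" for n
  proof (induction n)
    case 0
    show ?case using scaleC_of_real[of 1 "ket 0"] by simp
  next
    case (Suc n)
    then show ?case by (simp add: T weighted_shift_ket[OF b] scaleC_scaleC)
  qed
  moreover have "(\<Prod>i<n. \<alpha> i)\<^sup>2 = moment \<alpha> n"
    by (induction n) (simp_all add: power_mult_distrib)
  ultimately show ?thesis
    by (simp add: norm_scaleC norm_ket del: of_real_prod)
qed

text \<open>A singular matrix has a nonzero kernel vector. Its entries are kept as a function on
  indices, so that they serve directly as recursion coefficients.\<close>

lemma det_hankel_matrix_eq_0_iff: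
  "det (hankel_matrix \<gamma> n k) = 0 \<longleftrightarrow>
    (\<exists>v. (\<exists>j\<le>k. v j \<noteq> 0) \<and> (\<forall>i\<le>k. (\<Sum>j\<le>k. v j * \<gamma> (n + i + j)) = 0))"
proof -
  let ?H = "hankel_matrix \<gamma> n k"
  have H: "?H \<in> carrier_mat (k + 1) (k + 1)"
    by (simp add: hankel_matrix_def)
  have row: "(?H *\<^sub>v w) $ i = (\<Sum>j\<le>k. w $ j * \<gamma> (n + i + j))"
    if "w \<in> carrier_vec (k + 1)" "i \<le> k" for w i
    using that by (simp add: hankel_matrix_def scalar_prod_def atLeast0LessThan lessThan_Suc_atMost
        mult.commute)
  have null: "?H *\<^sub>v w = 0\<^sub>v (k + 1) \<longleftrightarrow> (\<forall>i\<le>k. (\<Sum>j\<le>k. w $ j * \<gamma> (n + i + j)) = 0)"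
    if w: "w \<in> carrier_vec (k + 1)" for w
    using H by (auto simp: row[OF w, symmetric] vec_eq_iff less_Suc_eq_le)
  show ?thesis (is "?L \<longleftrightarrow> ?R")
  proof
    assume ?L
    then obtain w where w: "w \<in> carrier_vec (k + 1)" "w \<noteq> 0\<^sub>v (k + 1)" "?H *\<^sub>v w = 0\<^sub>v (k + 1)"
      using det_0_iff_vec_prod_zero[OF H] by blast
    then have "\<exists>j\<le>k. w $ j \<noteq> 0"
      by (auto simp: vec_eq_iff less_Suc_eq_le)
    then show ?R
      using w null[OF w(1)] by (intro exI[of _ "\<lambda>j. w $ j"]) simp
  next
    assume ?R
    then obtain v where v: "\<exists>j\<le>k. v j \<noteq> 0" "\<forall>i\<le>k. (\<Sum>j\<le>k. v j * \<gamma> (n + i + j)) = 0"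
      by blast
    have "vec (k + 1) v \<noteq> 0\<^sub>v (k + 1)"
      using v(1) by (auto simp: vec_eq_iff less_Suc_eq_le)
    moreover have "?H *\<^sub>v vec (k + 1) v = 0\<^sub>v (k + 1)"
      using v(2) by (subst null) simp_all
    ultimately show ?L
      using det_0_iff_vec_prod_zero[OF H] vec_carrier by blast
  qed
qed

text \<open>The shift by one costs an extra order: the recursion has \<open>a\<^sub>0 = 0\<close>.\<close>

lemma recursively_generatedI:
  assumes nz: "\<exists>j\<le>k. v j \<noteq> 0"
    and rec: "\<And>m. (\<Sum>j\<le>k. v j * moment \<alpha> (Suc m + j)) = 0"
  shows "recursively_generated \<alpha>"
proof -
  \<comment> \<open>The last nonzero coefficient can be divided out, which solves the relation for
    its highest moment.\<close>
  define d where "d = Max {j. j \<le> k \<and> v j \<noteq> 0}"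
  have d: "d \<le> k" "v d \<noteq> 0"
    using Max_in[of "{j. j \<le> k \<and> v j \<noteq> 0}"] nz by (auto simp: d_def)
  have above: "v j = 0" if "d < j" "j \<le> k" for j
    using Max_ge[of "{j. j \<le> k \<and> v j \<noteq> 0}" j] that by (fastforce simp: d_def)
  define a where "a i = (case i of 0 \<Rightarrow> 0 | Suc j \<Rightarrow> - v j / v d)" for i
  have "moment \<alpha> (m + Suc d) = (\<Sum>i<Suc d. a i * moment \<alpha> (m + i))" for m
  proof -
    have "(\<Sum>j\<le>d. v j * moment \<alpha> (Suc m + j)) = (\<Sum>j\<le>k. v j * moment \<alpha> (Suc m + j))"
      using d(1) above by (intro sum.mono_neutral_left) auto
    then have "v d * moment \<alpha> (Suc m + d) = - (\<Sum>j<d. v j * moment \<alpha> (Suc m + j))"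
      using rec[of m] by (simp add: lessThan_Suc_atMost[symmetric])
    then have "moment \<alpha> (m + Suc d) = - (\<Sum>j<d. v j * moment \<alpha> (Suc m + j)) / v d"
      using d(2) by (simp add: field_simps)
    also have "\<dots> = (\<Sum>i<Suc d. a i * moment \<alpha> (m + i))"
      by (subst sum.lessThan_Suc_shift)
        (simp add: a_def sum_negf sum_divide_distrib)
    finally show ?thesis .
  qed
  then show ?thesis
    unfolding recursively_generated_def by (intro exI[of _ "Suc d"]) auto
qed

theorem theorem3p4:
  fixes \<alpha> :: "nat \<Rightarrow> real"
  assumes "\<And>n. \<alpha> n > 0"
    and "Bseq \<alpha>"
    and "subnormal_in TYPE('k::chilbert_space) (weighted_shift \<alpha>)"
  shows "recursively_generated \<alpha> \<longleftrightarrow> (\<exists>n\<^sub>0 k. det (hankel_matrix (moment \<alpha>) n\<^sub>0 k) = 0)"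
proof
  assume "recursively_generated \<alpha>"
  then obtain r a where rec: "\<And>m. moment \<alpha> (m + r) = (\<Sum>i<r. a i * moment \<alpha> (m + i))"
    by (auto simp: recursively_generated_def)
  \<comment> \<open>Moving the leading term of the recursion to the other side gives a null vector
    of the Hankel matrix with offset 0 and \<open>k = r\<close>; its last entry -1 makes it
    nonzero.\<close>
  define v where "v j = (if j = r then - 1 else a j)" for j
  have "(\<Sum>j\<le>r. v j * moment \<alpha> (0 + i + j)) = 0" for i
    by (simp add: lessThan_Suc_atMost[symmetric] v_def rec)
  moreover have "v r \<noteq> 0"
    by (simp add: v_def)
  ultimately show "\<exists>n\<^sub>0 k. det (hankel_matrix (moment \<alpha>) n\<^sub>0 k) = 0"
    unfolding det_hankel_matrix_eq_0_iff by blast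
next
  assume "\<exists>n\<^sub>0 k. det (hankel_matrix (moment \<alpha>) n\<^sub>0 k) = 0"
  then obtain n k v where nz: "\<exists>j\<le>k. v j \<noteq> 0"
    and null: "\<And>i. i \<le> k \<Longrightarrow> (\<Sum>j\<le>k. v j * moment \<alpha> (n + i + j)) = 0"
    unfolding det_hankel_matrix_eq_0_iff by blast
  obtain b where b: "\<And>n. \<bar>\<alpha> n\<bar> \<le> b"
    using assms(2) by (auto simp: Bseq_def)
  obtain V :: "ell2 \<Rightarrow> 'k" and N where V: "isometric_embedding V" and N: "normal_operator N"
    and NV: "\<And>x. N (V x) = V (weighted_shift \<alpha> x)"
    using assms(3) by (auto simp: subnormal_in_def)
  have norm_V: "norm (V x) = norm x" for x
  proof -
    have "complex_of_real ((norm (V x))\<^sup>2) = complex_of_real ((norm x)\<^sup>2)"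
      using V by (metis isometric_embedding_def cinner_self)
    then show ?thesis
      by (metis of_real_eq_iff norm_ge_zero power2_eq_iff_nonneg)
  qed
  \<comment> \<open>\<open>V\<close> intertwines the shift with \<open>N\<close>, so the squared
    norms along the \<open>N\<close>-orbit of \<open>V (ket 0)\<close> are the moments.\<close>
  have "(N ^^ m) (V x) = V ((weighted_shift \<alpha> ^^ m) x)" for m x
    by (induction m) (simp_all add: NV)
  then have moment: "(norm ((N ^^ m) (V (ket 0))))\<^sup>2 = moment \<alpha> m" for m
    by (simp add: norm_V norm_weighted_shift_funpow_ket[OF b])
  show "recursively_generated \<alpha>"
    using normal_orbit_recursion[OF N, of k v n "V (ket 0)"] null
    by (intro recursively_generatedI[OF nz]) (simp only: moment)
qed

end
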